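(* Let $\mathcal M$ be the class of all enumerable semimeasures on sequences over a finite alphabet. Within the set $\mathcal V$ of enumerable weight functions with short program, the universal weights $w_\nu=2^{-K(\nu)}$ lead to the smallest loss bounds, within an additive constant (additive to $\ln w_\mu^{-1}$), in all enumerable environments. Precisely: $w$ is itself an enumerable weight function with $\sum_{\nu}w_\nu\le 1$ and $K(w)=O(1)$, and for every constant $c$ there is a constant $C$ such that for every enumerable weight function $v:\mathcal M\to(0,\infty)$ with $\sum_{\nu\in\mathcal M}v_\nu\le1$ and $K(v)\le c$, $$\ln w_\nu^{-1}\le\ln v_\nu^{-1}+C\qquad\text{for all }\nu\in\mathcal M.$$ Consequently, for every $\nu\in\mathcal M$, the bounds $B_S(\ln w_\nu^{-1})$ and $B_L(\ln w_\nu^{-1})$ for $\xi_w$ are at most $B_S(\ln v_\nu^{-1}+C)$ and $B_L(\ln v_\nu^{-1}+C)$ respectively, where $B_S(b)=b$ and $B_L(b)=2b+2\sqrt{b\,L_{n\nu}^{\Lambda_\nu}}$.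
   Context: A semimeasure $\nu$ on sequences satisfies $\nu(\text{empty string})\le1$ and $\sum_{x_t}\nu(x_{1:t})\le\nu(x_{<t})$, $\nu\ge0$. A real-valued function is enumerable if it can be approximated from below by a computable non-decreasing sequence of rational-valued functions (lower semicomputable). $\mathcal M$ is the (multi)set $\{\nu_1,\nu_2,\ldots\}$ enumerated by a Turing machine which effectively enumerates all enumerable semimeasures. Weight functions on $\mathcal M$ are functions of the (program) index describing $\nu$, and $K(\nu)$ is the prefix Kolmogorov complexity (length of a shortest self-delimiting program on a fixed universal Turing machine) of this index. For an enumerable weight function $v$, $K(v)$ is the length of a shortest self-delimiting program enumerating $v$ from below. The set of weight functions considered is $\mathcal V=\{v:\mathcal M\to\mathbb R^+\text{ enumerable},\ \sum_\nu v_\nu\le1,\ K(v)=O(1)\}$. For weights $v$, $\xi_v=\sum_{\nu\in\mathcal M}v_\nu\nu$. The bounds referred to are, in environment $\nu$: the bound $B_S(\ln v_\nu^{-1})$ on the $\nu$-expected cumulative squared distance $\sum_{t\le n}\sum_{x_t}(\nu(x_t|x_{<t})-\xi_v(x_t|x_{<t}))^2$, and the bound $B_L(\ln v_\nu^{-1})$ on the loss regret $L_{n\nu}^{\Lambda_{\xi_v}}-L_{n\nu}^{\Lambda_\nu}$. Here, for a given loss function $\ell_{xy}\in[0,1]$, $\Lambda_\rho$ is the scheme choosing in each step the action $y_t$ minimizing $\sum_{x_t}\rho(x_t|x_{<t})\ell_{x_ty_t}$, and $L_{n\nu}^{\Lambda}=\sum_{t=1}^n\sum_{x_{1:t}}\nu(x_{1:t})\ell_{x_ty_t^\Lambda}$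 is the total $\nu$-expected loss of scheme $\Lambda$ in the first $n$ steps. *)

theory Defs
  imports
    Complex_Main
    "HOL-Library.Nat_Bijection"
    "HOL-Library.Countable"
    "HOL-Library.Extended_Nat"
    "HOL-Library.Sublist"
begin

section \<open>Computability\<close>

text \<open>Unbounded search: the value is undefined if the search meets an undefined value before
  the first zero.\<close>

definition mu :: "(nat \<Rightarrow> nat option) \<Rightarrow> nat option" where
  "mu g = (if \<exists>n. g n = Some 0 \<and> (\<forall>m<n. \<exists>k. g m = Some (Suc k))
           then Some (LEAST n. g n = Some 0) else None)"

text \<open>The partial recursive functions, with tuples coded by the Cantor pairing function
  \<^const>\<open>prod_encode\<close>, so that unary functions suffice.\<close>

inductive partrec :: "(nat \<Rightarrow> nat option) \<Rightarrow> bool" where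
  zero: "partrec (\<lambda>_. Some 0)"
| succ: "partrec (\<lambda>n. Some (Suc n))"
| left: "partrec (\<lambda>n. Some (fst (prod_decode n)))"
| right: "partrec (\<lambda>n. Some (snd (prod_decode n)))"
| pair: "partrec f \<Longrightarrow> partrec g \<Longrightarrow>
    partrec (\<lambda>n. Option.bind (f n) (\<lambda>a. Option.bind (g n) (\<lambda>b. Some (prod_encode (a, b)))))"
| comp: "partrec f \<Longrightarrow> partrec g \<Longrightarrow> partrec (\<lambda>n. Option.bind (g n) f)"
| prec: "partrec f \<Longrightarrow> partrec g \<Longrightarrow>
    partrec (\<lambda>n. case prod_decode n of (a, k) \<Rightarrow>
      rec_nat (f a) (\<lambda>j r. Option.bind r (\<lambda>b. g (prod_encode (a, prod_encode (j, b))))) k)"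
| search: "partrec f \<Longrightarrow> partrec (\<lambda>a. mu (\<lambda>n. f (prod_encode (a, n))))"

definition rat_decode :: "nat \<Rightarrow> rat" where
  "rat_decode n = (case prod_decode n of (a, b) \<Rightarrow> of_int (int_decode a) / of_nat (Suc b))"

text \<open>\<open>approximates_below code \<phi> f\<close>: the partial function \<open>\<phi>\<close>, run on an argument \<open>x\<close>
  (coded by \<open>code x\<close>) and a stage \<open>t\<close>, always halts with a code of a rational \<open>a x t\<close>,
  non-decreasing in \<open>t\<close>, with limit \<open>f x\<close>.\<close>

definition approximates_below ::
    "('b \<Rightarrow> nat) \<Rightarrow> (nat \<Rightarrow> nat option) \<Rightarrow> ('b \<Rightarrow> real) \<Rightarrow> bool" where
  "approximates_below code \<phi> f \<longleftrightarrow>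
     (\<exists>a :: 'b \<Rightarrow> nat \<Rightarrow> rat.
        (\<forall>x t. map_option rat_decode (\<phi> (prod_encode (code x, t))) = Some (a x t)) \<and>
        (\<forall>x. incseq (a x)) \<and>
        (\<forall>x. (\<lambda>t. real_of_rat (a x t)) \<longlonglongrightarrow> f x))"

definition enumerable :: "('b \<Rightarrow> nat) \<Rightarrow> ('b \<Rightarrow> real) \<Rightarrow> bool" where
  "enumerable code f \<longleftrightarrow> (\<exists>\<phi>. partrec \<phi> \<and> approximates_below code \<phi> f)"


section \<open>Prefix Kolmogorov complexity\<close>

text \<open>A machine takes a binary program and an input number. It is a prefix machine if its
  programs are self-delimiting: for every fixed input the set of halting programs is
  prefix-free.\<close>

type_synonym machine = "bool list \<Rightarrow> nat \<Rightarrow> nat option"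

definition prefix_machine :: "machine \<Rightarrow> bool" where
  "prefix_machine V \<longleftrightarrow>
     (\<exists>\<phi>. partrec \<phi> \<and> (\<forall>p y. V p y = \<phi> (prod_encode (list_encode (map of_bool p), y)))) \<and>
     (\<forall>y p q. V p y \<noteq> None \<and> V q y \<noteq> None \<and> prefix p q \<longrightarrow> p = q)"

definition universal_prefix_machine :: "machine \<Rightarrow> bool" where
  "universal_prefix_machine U \<longleftrightarrow>
     prefix_machine U \<and> (\<forall>V. prefix_machine V \<longrightarrow> (\<exists>s. \<forall>p y. U (s @ p) y = V p y))"

definition shortest :: "(bool list \<Rightarrow> bool) \<Rightarrow> enat" where
  "shortest P = (INF p\<in>{p. P p}. enat (length p))"

text \<open>Unconditional complexity of a number: the empty input is represented by \<open>0\<close>.\<close>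

definition K :: "machine \<Rightarrow> nat \<Rightarrow> enat" where
  "K U i = shortest (\<lambda>p. U p 0 = Some i)"

text \<open>Complexity of a real function on the naturals: length of a shortest program which
  enumerates it from below; \<open>\<infinity>\<close> if there is none.\<close>

definition K_fun :: "machine \<Rightarrow> (nat \<Rightarrow> real) \<Rightarrow> enat" where
  "K_fun U v = shortest (\<lambda>p. approximates_below id (U p) v)"


section \<open>Enumerable semimeasures and weights\<close>

definition semimeasure :: "('a::finite list \<Rightarrow> real) \<Rightarrow> bool" where
  "semimeasure \<rho> \<longleftrightarrow>
     \<rho> [] \<le> 1 \<and> (\<forall>x. 0 \<le> \<rho> x) \<and> (\<forall>x. (\<Sum>a\<in>UNIV. \<rho> (x @ [a])) \<le> \<rho> x)"

text \<open>\<^const>\<open>to_nat\<close> is an unspecified injection, but as the alphabet is finite, any two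
  injections differ by a finite table, so computability does not depend on it.\<close>

definition string_code :: "'a::finite list \<Rightarrow> nat" where
  "string_code x = list_encode (map to_nat x)"

text \<open>The class of all enumerable semimeasures as an effectively enumerated family (with
  repetitions allowed): the members are approximable from below uniformly in the index.\<close>

definition enumerates_semimeasures :: "(nat \<Rightarrow> 'a::finite list \<Rightarrow> real) \<Rightarrow> bool" where
  "enumerates_semimeasures \<nu> \<longleftrightarrow>
     range \<nu> = {\<rho>. semimeasure \<rho> \<and> enumerable string_code \<rho>} \<and>
     enumerable (\<lambda>(i, x). prod_encode (i, string_code x)) (\<lambda>(i, x). \<nu> i x)"

text \<open>Weights are functions of the index \<open>i\<close> describing the semimeasure \<open>\<nu> i\<close>, and the
  complexity of \<open>\<nu> i\<close> is that of \<open>i\<close>.\<close>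

definition weight_functions :: "machine \<Rightarrow> nat \<Rightarrow> (nat \<Rightarrow> real) set" where
  "weight_functions U c =
     {v. (\<forall>i. 0 < v i) \<and> enumerable id v \<and> summable v \<and> suminf v \<le> 1 \<and> K_fun U v \<le> enat c}"

definition universal_weight :: "machine \<Rightarrow> nat \<Rightarrow> real" where
  "universal_weight U i = (case K U i of enat k \<Rightarrow> 2 powr (- real k) | \<infinity> \<Rightarrow> 0)"


section \<open>Prediction loss and bounds\<close>

definition cond :: "('a list \<Rightarrow> real) \<Rightarrow> 'a list \<Rightarrow> 'a \<Rightarrow> real" where
  "cond \<rho> h x = \<rho> (h @ [x]) / \<rho> h"

text \<open>\<open>optimal_scheme \<rho> l \<Lambda>\<close>: in each history, \<open>\<Lambda>\<close> chooses an action of minimal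
  \<open>\<rho>\<close>-expected loss. Ties may be broken arbitrarily; this does not affect
  \<open>total_loss \<rho> l \<Lambda> n\<close>.\<close>

definition optimal_scheme ::
    "('a::finite list \<Rightarrow> real) \<Rightarrow> ('a \<Rightarrow> 'y \<Rightarrow> real) \<Rightarrow> ('a list \<Rightarrow> 'y) \<Rightarrow> bool" where
  "optimal_scheme \<rho> l \<Lambda> \<longleftrightarrow>
     (\<forall>h. is_arg_min (\<lambda>y. \<Sum>x\<in>UNIV. cond \<rho> h x * l x y) (\<lambda>_. True) (\<Lambda> h))"

definition total_loss ::
    "('a::finite list \<Rightarrow> real) \<Rightarrow> ('a \<Rightarrow> 'y \<Rightarrow> real) \<Rightarrow> ('a list \<Rightarrow> 'y) \<Rightarrow> nat \<Rightarrow> real" where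
  "total_loss \<rho> l \<Lambda> n =
     (\<Sum>t=1..n. \<Sum>x | length x = t. \<rho> x * l (last x) (\<Lambda> (butlast x)))"

definition B_S :: "real \<Rightarrow> real" where
  "B_S b = b"

text \<open>The parameter \<open>L\<close> is the total loss of the scheme that is optimal for the true
  environment.\<close>

definition B_L :: "real \<Rightarrow> real \<Rightarrow> real" where
  "B_L L b = 2 * b + 2 * sqrt (b * L)"

end

theory Submission
  imports Defs
begin

text \<open>
  A weight function \<open>v\<close> with total mass at most \<open>1\<close> that can be approximated from below is turned
  into a prefix code by the Kraft-Chaitin construction: whenever the approximation of \<open>v\<^sub>i\<close> first
  exceeds \<open>2\<^sup>-\<^sup>k\<close>, a codeword of length \<open>k + 2\<close> for \<open>i\<close> is requested; the requested mass is at
  most \<open>\<Sum> v\<^sub>i\<close>. The universal machine simulates the resulting decoder, so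
  \<open>K(i) \<le> -log v\<^sub>i + O(1)\<close>. Only finitely many \<open>v\<close> satisfy \<open>K(v) \<le> c\<close>, because a program
  determines the function it enumerates, hence one constant serves them all. That \<open>2\<^sup>-\<^sup>K\<close> is itself
  such a weight function follows from Kraft's inequality and the enumerability of \<open>K(i) \<le> k\<close>.

  Machines are never programmed explicitly: a recursively enumerable relation, given by a formula, is
  uniformized by a partial recursive function.
\<close>

section \<open>Recursive functions and decidable predicates\<close>

abbreviation pfst :: "nat \<Rightarrow> nat" where "pfst n \<equiv> fst (prod_decode n)"
abbreviation psnd :: "nat \<Rightarrow> nat" where "psnd n \<equiv> snd (prod_decode n)"

definition recf :: "(nat \<Rightarrow> nat) \<Rightarrow> bool" where
  "recf f \<longleftrightarrow> partrec (\<lambda>n. Some (f n))"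

definition recp :: "(nat \<Rightarrow> bool) \<Rightarrow> bool" where
  "recp P \<longleftrightarrow> recf (\<lambda>n. of_bool (P n))"

text \<open>The closure rules work on functions of a single number that codes the values of all
  variables in scope: a binder extends it by pairing, so that under a binder \<^term>\<open>pfst z\<close>
  stands for the outer variables and \<^term>\<open>psnd z\<close> for the bound one.\<close>

named_theorems rec_intros

lemma recf_comp: "recf f \<Longrightarrow> recf g \<Longrightarrow> recf (\<lambda>x. f (g x))"
  unfolding recf_def using partrec.comp by fastforce

lemma recf_pair [rec_intros]: "recf f \<Longrightarrow> recf g \<Longrightarrow> recf (\<lambda>x. prod_encode (f x, g x))"
  unfolding recf_def using partrec.pair by fastforce

lemma recf_pfst [rec_intros]: "recf f \<Longrightarrow> recf (\<lambda>x. pfst (f x))"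
  by (rule recf_comp) (simp_all add: recf_def partrec.left)

lemma recf_psnd [rec_intros]: "recf f \<Longrightarrow> recf (\<lambda>x. psnd (f x))"
  by (rule recf_comp) (simp_all add: recf_def partrec.right)

lemma recf_Suc [rec_intros]: "recf f \<Longrightarrow> recf (\<lambda>x. Suc (f x))"
  by (rule recf_comp) (simp_all add: recf_def partrec.succ)

lemma recf_id [rec_intros]: "recf (\<lambda>x. x)"
  using recf_pair[of pfst psnd] by (simp add: recf_def partrec.left partrec.right)

lemma recf_const [rec_intros]: "recf (\<lambda>x. c)"
  by (induction c) (use recf_Suc in \<open>auto simp: recf_def partrec.zero\<close>)

text \<open>The recursion carries the outer variables along as its parameter, so the step
  \<open>g\<close> may refer to everything in scope; the step receives them paired with the counter
  and the value so far.\<close>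

lemma recf_rec [rec_intros]:
  assumes "recf f" and "recf (\<lambda>z. g (pfst z) (pfst (psnd z)) (psnd (psnd z)))" and "recf h"
  shows "recf (\<lambda>x. rec_nat (f x) (g x) (h x))"
proof -
  have "rec_nat (Some (f a)) (\<lambda>j r. Option.bind r (\<lambda>b. Some (g a j b))) k = Some (rec_nat (f a) (g a) k)"
    for a k by (induction k) auto
  with partrec.prec[of "\<lambda>x. Some (f x)", OF _ assms(2)[unfolded recf_def]] assms(1)
  have "recf (\<lambda>n. rec_nat (f (pfst n)) (g (pfst n)) (psnd n))"
    by (simp add: recf_def split_def)
  from recf_comp[OF this recf_pair[OF recf_id assms(3)]] show ?thesis
    by simp
qed

lemma recf_add [rec_intros]:
  assumes "recf f" "recf g" shows "recf (\<lambda>x. f x + g x)"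
proof -
  have eq: "m + n = rec_nat m (\<lambda>_ r. Suc r) n" for m n :: nat by (induction n) auto
  show ?thesis unfolding eq by (intro rec_intros assms)
qed

lemma recf_mult [rec_intros]:
  assumes "recf f" "recf g" shows "recf (\<lambda>x. f x * g x)"
proof -
  have eq: "m * n = rec_nat 0 (\<lambda>_ r. r + m) n" for m n :: nat by (induction n) auto
  show ?thesis unfolding eq by (intro rec_intros recf_comp[OF assms(1)] assms)
qed

lemma recf_pred:
  assumes "recf f" shows "recf (\<lambda>x. f x - Suc 0)"
proof -
  have eq: "n - Suc 0 = rec_nat 0 (\<lambda>j _. j) n" for n by (cases n) auto
  show ?thesis unfolding eq by (intro rec_intros assms)
qed

lemma recf_diff [rec_intros]:
  assumes "recf f" "recf g" shows "recf (\<lambda>x. f x - g x)"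
proof -
  have "rec_nat m (\<lambda>_ r. r - Suc 0) n = m - n" for m n :: nat by (induction n) auto
  moreover have "recf (\<lambda>x. rec_nat (f x) (\<lambda>_ r. r - Suc 0) (g x))"
    by (intro rec_intros recf_pred assms)
  ultimately show ?thesis by simp
qed

lemma recf_power [rec_intros]:
  assumes "recf f" shows "recf (\<lambda>x. c ^ f x)"
proof -
  have eq: "c ^ n = rec_nat 1 (\<lambda>_ r. c * r) n" for n by (induction n) auto
  show ?thesis unfolding eq by (intro rec_intros assms)
qed

lemma recf_sum [rec_intros]:
  assumes "recf (\<lambda>z. f (pfst z) (psnd z))" "recf g"
  shows "recf (\<lambda>x. \<Sum>j<g x. f x j)"
proof -
  have eq: "(\<Sum>j<n. f x j) = rec_nat 0 (\<lambda>j r. r + f x j) n" for x n by (induction n) auto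
  \<comment> \<open>The recursor passes \<open>x\<close>, \<open>j\<close> and the sum so far;
    re-pairing keeps only \<open>x\<close> and \<open>j\<close>.\<close>
  have "recf (\<lambda>z. f (pfst z) (pfst (psnd z)))"
    using recf_comp[OF assms(1), of "\<lambda>z. prod_encode (pfst z, pfst (psnd z))"]
    by (simp add: rec_intros)
  then show ?thesis unfolding eq by (intro rec_intros assms)
qed

section \<open>Closure properties of decidable predicates\<close>

lemma recp_comp: "recp P \<Longrightarrow> recf f \<Longrightarrow> recp (\<lambda>x. P (f x))"
  unfolding recp_def by (rule recf_comp)

lemma recp_not [rec_intros]:
  assumes "recp P" shows "recp (\<lambda>x. \<not> P x)"
proof -
  have eq: "of_bool (\<not> b) = 1 - (of_bool b :: nat)" for b by simp
  show ?thesis unfolding recp_def eq by (intro rec_intros assms[unfolded recp_def])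
qed

lemma recp_conj [rec_intros]:
  assumes "recp P" "recp Q" shows "recp (\<lambda>x. P x \<and> Q x)"
  unfolding recp_def of_bool_conj by (intro rec_intros assms[unfolded recp_def])

lemma recp_disj [rec_intros]:
  assumes "recp P" "recp Q" shows "recp (\<lambda>x. P x \<or> Q x)"
proof -
  have eq: "p \<or> q \<longleftrightarrow> \<not> (\<not> p \<and> \<not> q)" for p q by simp
  show ?thesis unfolding eq by (intro rec_intros assms)
qed

lemma recp_le [rec_intros]:
  assumes "recf f" "recf g" shows "recp (\<lambda>x. f x \<le> g x)"
proof -
  have eq: "of_bool (m \<le> n) = 1 - (m - n)" for m n :: nat by simp
  show ?thesis unfolding recp_def eq by (intro rec_intros assms)
qed

lemma recp_less [rec_intros]: "recf f \<Longrightarrow> recf g \<Longrightarrow> recp (\<lambda>x. f x < g x)"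
  unfolding less_eq_Suc_le by (intro rec_intros)

lemma recp_eq [rec_intros]: "recf f \<Longrightarrow> recf g \<Longrightarrow> recp (\<lambda>x. f x = g x)"
  unfolding eq_iff by (intro rec_intros)

lemma recf_if [rec_intros]:
  assumes "recp P" "recf f" "recf g" shows "recf (\<lambda>x. if P x then f x else g x)"
proof -
  have eq: "(if p then m else n) = of_bool p * m + (1 - of_bool p) * n" for p and m n :: nat
    by simp
  show ?thesis unfolding eq by (intro rec_intros assms assms(1)[unfolded recp_def])
qed

lemma recp_all_less [rec_intros]:
  assumes "recp (\<lambda>z. P (pfst z) (psnd z))" "recf g"
  shows "recp (\<lambda>x. \<forall>j<g x. P x j)"
proof -
  have eq: "(\<forall>j<n. P x j) \<longleftrightarrow> (\<Sum>j<n. of_bool (\<not> P x j)) = (0 :: nat)" for x n by auto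
  show ?thesis unfolding eq
    by (intro rec_intros assms recp_not[OF assms(1), unfolded recp_def])
qed

lemma recp_ex_less [rec_intros]:
  assumes "recp (\<lambda>z. P (pfst z) (psnd z))" "recf g"
  shows "recp (\<lambda>x. \<exists>j<g x. P x j)"
proof -
  have eq: "(\<exists>j<n. P x j) \<longleftrightarrow> \<not> (\<forall>j<n. \<not> P x j)" for x n by auto
  show ?thesis unfolding eq by (intro rec_intros assms)
qed

text \<open>Eliminates \<open>LEAST\<close>: all values before \<open>n\<close> are successors, so
  no zero precedes it. What remains is a bounded quantifier, the form needed to show that the graph
  of a search is recursively enumerable.\<close>

lemma mu_eq_Some_iff:
  "mu h = Some n \<longleftrightarrow> h n = Some 0 \<and> (\<forall>m<n. \<exists>k. h m = Some (Suc k))"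
proof
  assume "mu h = Some n"
  then obtain n' where n': "h n' = Some 0" "\<forall>m<n'. \<exists>k. h m = Some (Suc k)"
    and n: "n = (LEAST n. h n = Some 0)"
    unfolding mu_def by (auto split: if_splits)
  have "(LEAST n. h n = Some 0) = n'"
    using n' by (intro Least_equality) (auto simp: not_less[symmetric])
  with n n' show "h n = Some 0 \<and> (\<forall>m<n. \<exists>k. h m = Some (Suc k))" by simp
next
  assume *: "h n = Some 0 \<and> (\<forall>m<n. \<exists>k. h m = Some (Suc k))"
  then have "(LEAST n. h n = Some 0) = n"
    by (intro Least_equality) (auto simp: not_less[symmetric])
  with * show "mu h = Some n" unfolding mu_def by auto
qed

lemma mu_of_bool:
  "mu (\<lambda>n. Some (of_bool (\<not> P n))) = (if \<exists>n. P n then Some (LEAST n. P n) else None)"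
proof (cases "\<exists>n. P n")
  case True
  then show ?thesis
    by (auto simp: mu_eq_Some_iff intro: LeastI dest: not_less_Least)
next
  case False
  then show ?thesis by (simp add: mu_def)
qed

lemma partrec_search:
  assumes "recp (\<lambda>z. P (pfst z) (psnd z))"
  shows "partrec (\<lambda>x. if \<exists>n. P x n then Some (LEAST n. P x n) else None)"
  using partrec.search[OF recp_not[OF assms, unfolded recp_def recf_def]]
  by (simp add: mu_of_bool)

lemma recf_Least [rec_intros]:
  assumes "recp (\<lambda>z. P (pfst z) (psnd z))" "\<And>x. \<exists>n. P x n"
  shows "recf (\<lambda>x. LEAST n. P x n)"
  using partrec_search[OF assms(1)] assms(2) by (simp add: recf_def)

section \<open>Finite sequences\<close>

text \<open>\<open>list_encode\<close> sends a nonempty list to the successor of the coded pair of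
  its head and the code of its tail, so \<open>psnd (r - 1)\<close> is the tail.\<close>

abbreviation ldrop :: "nat \<Rightarrow> nat \<Rightarrow> nat" where
  "ldrop s j \<equiv> rec_nat s (\<lambda>_ r. psnd (r - 1)) j"

definition lnth :: "nat \<Rightarrow> nat \<Rightarrow> nat" where
  "lnth s j = pfst (ldrop s j - 1)"

definition llen :: "nat \<Rightarrow> nat" where
  "llen s = (LEAST j. ldrop s j = 0)"

lemma ldrop_list_encode: "ldrop (list_encode xs) j = list_encode (drop j xs)"
proof (induction j)
  case (Suc j)
  \<comment> \<open>Covers the empty list: its code 0 must have tail 0, where the truncated
    subtraction gives \<open>0 - 1 = 0\<close>.\<close>
  have "prod_decode 0 = (0, 0)"
    using prod_encode_inverse[of "(0, 0)"] by (simp add: prod_encode_def)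
  then have "psnd (list_encode ys - 1) = list_encode (tl ys)" for ys
    by (cases ys) simp_all
  then show ?case by (simp add: Suc drop_Suc tl_drop del: One_nat_def)
qed simp

lemma list_encode_eq_0_iff: "list_encode xs = 0 \<longleftrightarrow> xs = []"
  by (cases xs) auto

lemma lnth_list_encode: "j < length xs \<Longrightarrow> lnth (list_encode xs) j = xs ! j"
  unfolding lnth_def ldrop_list_encode by (simp add: Cons_nth_drop_Suc[symmetric])

lemma llen_list_encode [simp]: "llen (list_encode xs) = length xs"
  unfolding llen_def ldrop_list_encode
  by (rule Least_equality) (auto simp: list_encode_eq_0_iff)

text \<open>Plays the role of Goedel's beta function: one number holds a whole finite table, so a
  quantifier over numbers can range over computation histories.\<close>

lemma ex_lnth: "\<exists>s. \<forall>j\<le>n. lnth s j = f j"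
  by (rule exI[of _ "list_encode (map f [0..<Suc n])"])
    (auto simp: lnth_list_encode simp del: upt_Suc)

lemma recf_lnth [rec_intros]: "recf f \<Longrightarrow> recf g \<Longrightarrow> recf (\<lambda>x. lnth (f x) (g x))"
  unfolding lnth_def by (intro rec_intros)

lemma recf_llen [rec_intros]:
  assumes "recf f" shows "recf (\<lambda>x. llen (f x))"
proof (rule recf_comp[OF _ assms])
  have "\<exists>j. ldrop s j = 0" for s
    using ldrop_list_encode[of "list_decode s" "length (list_decode s)"] by auto
  then show "recf llen"
    unfolding llen_def by (intro recf_Least rec_intros)
qed

section \<open>Recursively enumerable predicates\<close>

text \<open>A normal form with a decidable matrix and a single search variable; several witnesses
  are merged into it by pairing.\<close>

definition re :: "(nat \<Rightarrow> bool) \<Rightarrow> bool" where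
  "re P \<longleftrightarrow> (\<exists>D. recp D \<and> (\<forall>x. P x \<longleftrightarrow> (\<exists>t. D (prod_encode (x, t)))))"

lemma reI:
  assumes "recp (\<lambda>z. D (pfst z) (psnd z))" "\<And>x. P x \<longleftrightarrow> (\<exists>t. D x t)"
  shows "re P"
  unfolding re_def using assms by (intro exI[of _ "\<lambda>z. D (pfst z) (psnd z)"]) simp

lemma reE:
  assumes "re P"
  obtains D where "recp (\<lambda>z. D (pfst z) (psnd z))" "\<And>x. P x \<longleftrightarrow> (\<exists>t. D x t)"
proof -
  from assms obtain D where "recp D" "\<And>x. P x \<longleftrightarrow> (\<exists>t. D (prod_encode (x, t)))"
    unfolding re_def by blast
  then show ?thesis by (intro that[of "\<lambda>x t. D (prod_encode (x, t))"]) simp_all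
qed

lemma recp_comp2:
  assumes "recp (\<lambda>z. D (pfst z) (psnd z))" "recf f" "recf g"
  shows "recp (\<lambda>x. D (f x) (g x))"
  using recp_comp[OF assms(1) recf_pair[OF assms(2,3)]] by simp

lemma re_recp:
  assumes "recp P" shows "re P"
  by (rule reI[of "\<lambda>x t. P x"]) (intro recp_comp[OF assms] rec_intros, simp)

lemma re_comp:
  assumes "re P" "recf f" shows "re (\<lambda>x. P (f x))"
proof -
  from assms(1) obtain D where D: "recp (\<lambda>z. D (pfst z) (psnd z))" "\<And>x. P x \<longleftrightarrow> (\<exists>t. D x t)"
    by (rule reE) blast
  show ?thesis
    by (rule reI[of "\<lambda>x. D (f x)"])
      (intro recp_comp2[OF D(1)] recf_comp[OF assms(2)] rec_intros, simp add: D(2))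
qed

lemma re_conj [rec_intros]:
  assumes "re P" "re Q" shows "re (\<lambda>x. P x \<and> Q x)"
proof -
  from assms(1) obtain D where
    D: "recp (\<lambda>z. D (pfst z) (psnd z))" "\<And>x. P x \<longleftrightarrow> (\<exists>t. D x t)"
    by (rule reE) blast
  from assms(2) obtain E where
    E: "recp (\<lambda>z. E (pfst z) (psnd z))" "\<And>x. Q x \<longleftrightarrow> (\<exists>t. E x t)"
    by (rule reE) blast
  show ?thesis
  proof (rule reI[of "\<lambda>x t. D x (pfst t) \<and> E x (psnd t)"])
    show "recp (\<lambda>z. D (pfst z) (pfst (psnd z)) \<and> E (pfst z) (psnd (psnd z)))"
      by (intro recp_conj recp_comp2[OF D(1)] recp_comp2[OF E(1)] rec_intros)
    show "P x \<and> Q x \<longleftrightarrow> (\<exists>t. D x (pfst t) \<and> E x (psnd t))" for x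
      unfolding D(2) E(2) by (metis fst_conv prod_encode_inverse snd_conv)
  qed
qed

lemma re_ex [rec_intros]:
  assumes "re (\<lambda>z. P (pfst z) (psnd z))" shows "re (\<lambda>x. \<exists>n. P x n)"
proof -
  from assms obtain D where D: "recp (\<lambda>z. D (pfst z) (psnd z))"
    "\<And>z. P (pfst z) (psnd z) \<longleftrightarrow> (\<exists>t. D z t)"
    by (rule reE) blast
  show ?thesis
  proof (rule reI[of "\<lambda>x t. D (prod_encode (x, pfst t)) (psnd t)"])
    show "recp (\<lambda>z. D (prod_encode (pfst z, pfst (psnd z))) (psnd (psnd z)))"
      by (intro recp_comp2[OF D(1)] rec_intros)
    have "P x n \<longleftrightarrow> (\<exists>t. D (prod_encode (x, n)) t)" for x n
      using D(2)[of "prod_encode (x, n)"] by simp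
    then show "(\<exists>n. P x n) \<longleftrightarrow> (\<exists>t. D (prod_encode (x, pfst t)) (psnd t))" for x
      by (metis fst_conv prod_encode_inverse snd_conv)
  qed
qed

text \<open>Finitely many witnesses have a common bound, so the bounded quantifier can be moved
  inside the search for that bound.\<close>

lemma re_all_less [rec_intros]:
  assumes "re (\<lambda>z. P (pfst z) (psnd z))" "recf g" shows "re (\<lambda>x. \<forall>j<g x. P x j)"
proof -
  from assms(1) obtain D where D: "recp (\<lambda>z. D (pfst z) (psnd z))"
    "\<And>z. P (pfst z) (psnd z) \<longleftrightarrow> (\<exists>t. D z t)"
    by (rule reE) blast
  have P: "P x n \<longleftrightarrow> (\<exists>t. D (prod_encode (x, n)) t)" for x n
    using D(2)[of "prod_encode (x, n)"] by simp
  show ?thesis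
  proof (rule reI[of "\<lambda>x b. \<forall>j<g x. \<exists>t<b. D (prod_encode (x, j)) t"])
    show "recp (\<lambda>z. \<forall>j<g (pfst z). \<exists>t<psnd z. D (prod_encode (pfst z, j)) t)"
      by (intro recp_all_less recp_ex_less recp_comp2[OF D(1)] recf_comp[OF assms(2)] rec_intros)
    show "(\<forall>j<g x. P x j) \<longleftrightarrow> (\<exists>b. \<forall>j<g x. \<exists>t<b. D (prod_encode (x, j)) t)" for x
    proof
      assume "\<forall>j<g x. P x j"
      then obtain \<tau> where \<tau>: "\<And>j. j < g x \<Longrightarrow> D (prod_encode (x, j)) (\<tau> j)"
        unfolding P by metis
      have "\<tau> j < Suc (\<Sum>j<g x. \<tau> j)" if "j < g x" for j
        using member_le_sum[of j "{..<g x}" \<tau>] that by simp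
      with \<tau> show "\<exists>b. \<forall>j<g x. \<exists>t<b. D (prod_encode (x, j)) t" by blast
    qed (auto simp: P)
  qed
qed

text \<open>The search runs through pairs of a candidate value and a witness and returns the value
  of the first hit. As \<open>R\<close> may be multi-valued, only definedness can be claimed where
  \<open>R x m\<close> holds.\<close>

lemma partrec_uniformize:
  assumes "re (\<lambda>z. R (pfst z) (psnd z))"
  obtains \<phi> where "partrec \<phi>" "\<And>x m. \<phi> x = Some m \<Longrightarrow> R x m" "\<And>x m. R x m \<Longrightarrow> \<phi> x \<noteq> None"
proof -
  from assms obtain D where D: "recp (\<lambda>z. D (pfst z) (psnd z))"
    "\<And>z. R (pfst z) (psnd z) \<longleftrightarrow> (\<exists>t. D z t)"
    by (rule reE) blast
  define E where "E x n \<longleftrightarrow> D (prod_encode (x, pfst n)) (psnd n)" for x n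
  have R: "R x m \<longleftrightarrow> (\<exists>n. E x n \<and> pfst n = m)" for x m
    using D(2)[of "prod_encode (x, m)"] unfolding E_def
    by (metis fst_conv prod_encode_inverse snd_conv)
  define \<phi> where "\<phi> x = Option.bind (if \<exists>n. E x n then Some (LEAST n. E x n) else None)
    (\<lambda>n. Some (pfst n))" for x
  show ?thesis
  proof
    show "partrec \<phi>" unfolding \<phi>_def E_def
      by (intro partrec.comp partrec.left partrec_search recp_comp2[OF D(1)] rec_intros)
    show "R x m" if "\<phi> x = Some m" for x m
      using that unfolding \<phi>_def R by (auto split: if_splits intro: LeastI)
    show "\<phi> x \<noteq> None" if "R x m" for x m
      using that unfolding \<phi>_def R by auto
  qed
qed

lemma re_graph_comp:
  assumes "re (\<lambda>z. f (pfst z) = Some (psnd z))" "recf a" "recf b"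
  shows "re (\<lambda>x. f (a x) = Some (b x))"
  using re_comp[OF assms(1) recf_pair[OF assms(2,3)]] by simp

text \<open>Counterpart of uniformization: existing partial recursive functions may occur in the
  formulas that define new machines.\<close>

lemma re_graph_of_partrec: "partrec f \<Longrightarrow> re (\<lambda>z. f (pfst z) = Some (psnd z))"
proof (induction rule: partrec.induct)
  case (pair f g)
  have "Option.bind (f x) (\<lambda>a. Option.bind (g x) (\<lambda>b. Some (prod_encode (a, b)))) = Some m
      \<longleftrightarrow> f x = Some (pfst m) \<and> g x = Some (psnd m)" for x m
    by (auto simp: bind_eq_Some_conv)
  then show ?case
    by (simp only:) (intro re_conj re_graph_comp[OF pair.IH(1)] re_graph_comp[OF pair.IH(2)] rec_intros)
next
  case (comp f g)
  show ?case unfolding bind_eq_Some_conv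
    by (intro re_ex re_conj re_graph_comp[OF comp.IH(1)] re_graph_comp[OF comp.IH(2)] rec_intros)
next
  case (prec f g)
  define r where "r a k = rec_nat (f a)
    (\<lambda>j r. Option.bind r (\<lambda>b. g (prod_encode (a, prod_encode (j, b))))) k" for a k
  have r0: "r a 0 = f a" and rS: "r a (Suc j) = Option.bind (r a j)
    (\<lambda>b. g (prod_encode (a, prod_encode (j, b))))" for a j
    unfolding r_def by simp_all
  \<comment> \<open>The witness \<open>s\<close> is the history of the recursion, the list of its
    values at \<open>0, ..., k\<close>.\<close>
  have "r a k = Some m \<longleftrightarrow> (\<exists>s. f a = Some (lnth s 0) \<and>
      (\<forall>j<k. g (prod_encode (a, prod_encode (j, lnth s j))) = Some (lnth s (Suc j))) \<and>
      lnth s k = m)" for a k m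
  proof
    assume "r a k = Some m"
    \<comment> \<open>A recursion that is undefined once stays undefined, so definedness passes down
      from \<open>k\<close>.\<close>
    have some: "j \<le> k \<Longrightarrow> r a j \<noteq> None" for j
    proof (induction rule: inc_induct)
      case base then show ?case using \<open>r a k = Some m\<close> by simp
    next
      case (step j) then show ?case by (cases "r a j") (auto simp: rS)
    qed
    obtain s where "\<And>j. j \<le> k \<Longrightarrow> lnth s j = the (r a j)"
      using ex_lnth[of k "\<lambda>j. the (r a j)"] by blast
    with some have s: "j \<le> k \<Longrightarrow> r a j = Some (lnth s j)" for j by simp
    have "g (prod_encode (a, prod_encode (j, lnth s j))) = Some (lnth s (Suc j))" if "j < k" for j
      using s[of j] s[of "Suc j"] that by (simp add: rS)
    moreover have "f a = Some (lnth s 0)" "lnth s k = m"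
      using s[of 0] s[of k] \<open>r a k = Some m\<close> by (simp_all add: r0)
    ultimately show "\<exists>s. f a = Some (lnth s 0) \<and>
      (\<forall>j<k. g (prod_encode (a, prod_encode (j, lnth s j))) = Some (lnth s (Suc j))) \<and>
      lnth s k = m" by blast
  next
    assume "\<exists>s. f a = Some (lnth s 0) \<and>
      (\<forall>j<k. g (prod_encode (a, prod_encode (j, lnth s j))) = Some (lnth s (Suc j))) \<and>
      lnth s k = m"
    then obtain s where s: "f a = Some (lnth s 0)"
      "\<And>j. j < k \<Longrightarrow> g (prod_encode (a, prod_encode (j, lnth s j))) = Some (lnth s (Suc j))"
      "lnth s k = m" by blast
    have "j \<le> k \<Longrightarrow> r a j = Some (lnth s j)" for j
      by (induction j) (simp_all add: r0 rS s(1,2))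
    with s(3) show "r a k = Some m" by simp
  qed
  then show ?case unfolding split_def r_def[symmetric]
    by (simp only:) (intro re_ex re_conj re_all_less re_graph_comp[OF prec.IH(1)]
      re_graph_comp[OF prec.IH(2)] re_recp[OF recp_eq] rec_intros)
next
  case (search f)
  show ?case unfolding mu_eq_Some_iff
    by (intro re_conj re_ex re_all_less re_graph_comp[OF search.IH] rec_intros)
qed (unfold option.inject, (intro re_recp[OF recp_eq] rec_intros)+)

section \<open>Prefix machines\<close>

abbreviation string_enc :: "bool list \<Rightarrow> nat" where
  "string_enc p \<equiv> list_encode (map of_bool p)"

text \<open>Prefix-freeness is imposed on the domain of \<open>R\<close>, with unrelated
  \<open>m\<close> and \<open>m'\<close>, because the uniformizing function may select any related
  value.\<close>

lemma prefix_machine_uniformize: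
  assumes "re (\<lambda>z. R (pfst z) (psnd z))"
    and "\<And>p q y m m'. R (prod_encode (string_enc p, y)) m \<Longrightarrow>
      R (prod_encode (string_enc q, y)) m' \<Longrightarrow> prefix p q \<Longrightarrow> p = q"
  obtains V where "prefix_machine V"
    "\<And>p y m. V p y = Some m \<Longrightarrow> R (prod_encode (string_enc p, y)) m"
    "\<And>p y m. R (prod_encode (string_enc p, y)) m \<Longrightarrow> V p y \<noteq> None"
proof -
  from assms(1) obtain \<phi> where \<phi>: "partrec \<phi>" "\<And>x m. \<phi> x = Some m \<Longrightarrow> R x m"
    "\<And>x m. R x m \<Longrightarrow> \<phi> x \<noteq> None"
    by (rule partrec_uniformize) blast
  define V :: machine where "V p y = \<phi> (prod_encode (string_enc p, y))" for p y
  have "prefix_machine V"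
    unfolding prefix_machine_def
  proof (intro conjI exI[of _ \<phi>] allI impI)
    show "p = q" if "V p y \<noteq> None \<and> V q y \<noteq> None \<and> prefix p q" for y p q
      using that \<phi>(2) assms(2) unfolding V_def by blast
  qed (simp_all add: \<phi>(1) V_def)
  then show ?thesis
    by (rule that) (use \<phi>(2,3) in \<open>auto simp: V_def\<close>)
qed

text \<open>A machine that halts on the empty program only is trivially prefix-free; simulating it
  costs just the prefix \<open>s\<close>.\<close>

lemma universal_simulates_partrec:
  assumes "universal_prefix_machine U" "partrec \<phi>"
  obtains s where "U s = \<phi>"
proof -
  let ?R = "\<lambda>x m. pfst x = 0 \<and> \<phi> (psnd x) = Some m"
  have re: "re (\<lambda>z. ?R (pfst z) (psnd z))"
    by (intro re_conj re_recp[OF recp_eq] re_graph_comp[OF re_graph_of_partrec[OF assms(2)]]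
        rec_intros)
  obtain V where V: "prefix_machine V" "\<And>p y m. V p y = Some m \<Longrightarrow> p = [] \<and> \<phi> y = Some m"
    "\<And>y m. \<phi> y = Some m \<Longrightarrow> V [] y \<noteq> None"
    by (rule prefix_machine_uniformize[OF re]) (auto simp: list_encode_eq_0_iff)
  obtain s where s: "\<And>p y. U (s @ p) y = V p y"
    using assms(1) V(1) unfolding universal_prefix_machine_def by blast
  have "U s y = \<phi> y" for y
    using s[of "[]" y] V(2)[of "[]" y] V(3)[of y] by (cases "\<phi> y"; cases "V [] y") auto
  then show ?thesis by (intro that[of s] ext)
qed

section \<open>Shortest programs and finiteness of complexities\<close>

lemma shortest_le_iff: "shortest P \<le> enat k \<longleftrightarrow> (\<exists>p. P p \<and> length p \<le> k)"
proof
  assume le: "shortest P \<le> enat k"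
  show "\<exists>p. P p \<and> length p \<le> k"
  proof (rule ccontr)
    assume "\<not> (\<exists>p. P p \<and> length p \<le> k)"
    then have "enat (Suc k) \<le> shortest P"
      unfolding shortest_def by (intro INF_greatest) (auto simp: not_le)
    from order_trans[OF this le] show False by simp
  qed
next
  assume "\<exists>p. P p \<and> length p \<le> k"
  then obtain p where "P p" "length p \<le> k" by blast
  then show "shortest P \<le> enat k"
    unfolding shortest_def by (intro INF_lower2[of p]) auto
qed

lemma shortest_eqD:
  assumes "shortest P = enat k" obtains p where "P p" "length p = k"
proof -
  obtain p where p: "P p" "length p \<le> k" using shortest_le_iff[of P k] assms by auto
  then have "shortest P \<le> enat (length p)" by (auto simp: shortest_le_iff)
  with assms p show ?thesis by (intro that[of p]) auto
qed

lemma K_fun_finite: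
  assumes "universal_prefix_machine U" "enumerable id v"
  obtains c where "K_fun U v \<le> enat c"
proof -
  obtain \<phi> where \<phi>: "partrec \<phi>" "approximates_below id \<phi> v"
    using assms(2) unfolding enumerable_def by blast
  obtain s where "U s = \<phi>" using universal_simulates_partrec[OF assms(1) \<phi>(1)] .
  with \<phi>(2) have "K_fun U v \<le> enat (length s)"
    unfolding K_fun_def shortest_le_iff by blast
  then show ?thesis by (rule that)
qed

lemma K_finite:
  assumes "universal_prefix_machine U" obtains k where "K U i = enat k"
proof -
  obtain s where "U s = (\<lambda>_. Some i)"
    using universal_simulates_partrec[OF assms] recf_const[of i] unfolding recf_def by metis
  then have "K U i \<le> enat (length s)"
    unfolding K_def shortest_le_iff by (intro exI[of _ s]) simp
  then show ?thesis using that by (cases "K U i") auto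
qed

lemma universal_weight_eq: "K U i = enat k \<Longrightarrow> universal_weight U i = (1 / 2) ^ k"
  by (simp add: universal_weight_def powr_minus powr_realpow power_divide inverse_eq_divide)

lemma universal_weight_pos: "universal_prefix_machine U \<Longrightarrow> 0 < universal_weight U i"
  by (metis K_finite universal_weight_eq zero_less_divide_1_iff zero_less_numeral zero_less_power)

lemma universal_weight_ge:
  assumes "universal_prefix_machine U" "K U i \<le> enat k"
  shows "(1 / 2) ^ k \<le> universal_weight U i"
proof -
  obtain k' where k': "K U i = enat k'" using K_finite[OF assms(1)] .
  with assms(2) show ?thesis by (simp add: universal_weight_eq[OF k'] power_decreasing)
qed

section \<open>Kraft's inequality\<close>

lemma card_bool_lists: "card {p :: bool list. length p = n} = 2 ^ n"
  using card_lists_length_eq[of "UNIV :: bool set" n] by simp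

lemma finite_bool_lists: "finite {p :: bool list. length p \<le> n}"
  using finite_lists_length_le[of "UNIV :: bool set" n] by simp

text \<open>Extend each word to all strings of a common length \<open>L\<close>. Prefix-freeness
  makes the extensions of different words disjoint, and there are only \<open>2 ^ L\<close>
  strings.\<close>

lemma Kraft_inequality:
  fixes A :: "bool list set"
  assumes "finite A" and pf: "\<And>p q. p \<in> A \<Longrightarrow> q \<in> A \<Longrightarrow> prefix p q \<Longrightarrow> p = q"
  shows "(\<Sum>p\<in>A. (1 / 2) ^ length p :: real) \<le> 1"
proof -
  \<comment> \<open>The sum is merely a convenient upper bound for all lengths.\<close>
  define L where "L = (\<Sum>p\<in>A. length p)"
  have L: "length p \<le> L" if "p \<in> A" for p
    unfolding L_def using that assms(1) by (intro member_le_sum) auto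
  define E where "E p = append p ` {r. length r = L - length p}" for p :: "bool list"
  have card_E: "card (E p) = 2 ^ (L - length p)" for p
    unfolding E_def by (subst card_image) (auto simp: card_bool_lists inj_on_def)
  have fin: "finite (E p)" for p
    unfolding E_def using finite_bool_lists[of "L - length p"]
    by (intro finite_imageI) (rule rev_finite_subset, auto)
  have "E p \<inter> E q = {}" if "p \<in> A" "q \<in> A" "p \<noteq> q" for p q
  proof -
    have "prefix p q \<or> prefix q p" if "x \<in> E p" "x \<in> E q" for x
    proof -
      have "prefix p x" if "x \<in> E p" for p using that by (auto simp: E_def)
      with that have "prefix p x" "prefix q x" by blast+
      then show ?thesis using prefix_same_cases by blast
    qed
    with pf[OF that(1,2)] pf[OF that(2,1)] that(3) show ?thesis by auto
  qed
  then have "(\<Sum>p\<in>A. card (E p)) = card (\<Union>p\<in>A. E p)"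
    using assms(1) fin by (intro card_UN_disjoint[symmetric]) auto
  also have "\<dots> \<le> card {p :: bool list. length p = L}"
  proof (rule card_mono)
    show "finite {p :: bool list. length p = L}"
      by (rule rev_finite_subset[OF finite_bool_lists[of L]]) auto
    show "(\<Union>p\<in>A. E p) \<subseteq> {p. length p = L}" using L by (auto simp: E_def)
  qed
  finally have "(\<Sum>p\<in>A. 2 ^ (L - length p)) \<le> (2 ^ L :: nat)"
    by (simp only: card_E card_bool_lists)
  then have "real (\<Sum>p\<in>A. 2 ^ (L - length p)) \<le> real (2 ^ L)"
    by (rule of_nat_mono)
  then have "(\<Sum>p\<in>A. 2 ^ (L - length p)) \<le> (2 ^ L :: real)"
    by simp
  moreover have "(\<Sum>p\<in>A. 2 ^ (L - length p)) = (\<Sum>p\<in>A. (1 / 2) ^ length p) * (2 ^ L :: real)"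
    unfolding sum_distrib_right
    by (intro sum.cong refl) (simp add: L power_diff power_one_over)
  ultimately show ?thesis by simp
qed

text \<open>Shortest programs of different numbers are different and belong to the prefix-free set
  of programs halting on input \<open>0\<close>.\<close>

lemma sum_universal_weight_le_1:
  assumes U: "universal_prefix_machine U" and "finite F"
  shows "(\<Sum>i\<in>F. universal_weight U i) \<le> 1"
proof -
  have "\<forall>i. \<exists>p. U p 0 = Some i \<and> universal_weight U i = (1 / 2) ^ length p"
  proof
    fix i
    obtain k where k: "K U i = enat k" using K_finite[OF U] .
    then obtain p where "U p 0 = Some i" "length p = k"
      unfolding K_def by (rule shortest_eqD)
    with universal_weight_eq[OF k] show "\<exists>p. U p 0 = Some i \<and> universal_weight U i = (1 / 2) ^ length p"
      by blast
  qed
  from choice[OF this] obtain P where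
    "\<forall>i. U (P i) 0 = Some i \<and> universal_weight U i = (1 / 2) ^ length (P i)" ..
  then have P: "U (P i) 0 = Some i" "universal_weight U i = (1 / 2) ^ length (P i)" for i
    by blast+
  have "inj_on P F"
  proof (rule inj_onI)
    fix i j assume "P i = P j"
    then have "U (P i) 0 = U (P j) 0" by (rule arg_cong)
    then show "i = j" unfolding P(1) by (rule option.inject[THEN iffD1])
  qed
  then have "(\<Sum>i\<in>F. universal_weight U i) = (\<Sum>p\<in>P ` F. (1 / 2) ^ length p)"
    by (simp add: sum.reindex P(2))
  also have "\<dots> \<le> 1"
  proof (rule Kraft_inequality)
    show "p = q" if "p \<in> P ` F" "q \<in> P ` F" "prefix p q" for p q
    proof -
      from that(1,2) have "U p 0 \<noteq> None" "U q 0 \<noteq> None" using P(1) by auto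
      moreover have "\<forall>y p q. U p y \<noteq> None \<and> U q y \<noteq> None \<and> prefix p q \<longrightarrow> p = q"
        using conjunct1[OF U[unfolded universal_prefix_machine_def]]
        unfolding prefix_machine_def by (rule conjunct2)
      ultimately show ?thesis using that(3) by blast
    qed
  qed (use assms(2) in simp)
  finally show ?thesis .
qed

section \<open>Enumerability of the universal weights\<close>

lemma enumerable_idI:
  assumes "recf g" "\<And>x. incseq (\<lambda>t. rat_decode (g (prod_encode (x, t))))"
    "\<And>x. (\<lambda>t. real_of_rat (rat_decode (g (prod_encode (x, t))))) \<longlonglongrightarrow> f x"
  shows "enumerable id f"
  unfolding enumerable_def approximates_below_def
  by (rule exI[of _ "\<lambda>x. Some (g x)"], intro conjI
      exI[of _ "\<lambda>x t. rat_decode (g (prod_encode (x, t)))"])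
    (use assms in \<open>simp_all add: recf_def\<close>)

text \<open>Every number codes a pair of argument and stage, so the approximating partial function
  is in fact total.\<close>

lemma enumerable_idE:
  assumes "enumerable id f"
  obtains g where "recf g" "\<And>x. incseq (\<lambda>t. rat_decode (g (prod_encode (x, t))))"
    "\<And>x. (\<lambda>t. real_of_rat (rat_decode (g (prod_encode (x, t))))) \<longlonglongrightarrow> f x"
proof -
  from assms obtain \<phi> a where \<phi>: "partrec \<phi>"
    "\<And>x t. map_option rat_decode (\<phi> (prod_encode (x, t))) = Some (a x t)"
    "\<And>x. incseq (a x)" "\<And>x. (\<lambda>t. real_of_rat (a x t)) \<longlonglongrightarrow> f x"
    unfolding enumerable_def approximates_below_def by auto
  have "\<phi> n \<noteq> None" for n
    using \<phi>(2)[of "pfst n" "psnd n"] by auto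
  then have g: "Some (the (\<phi> n)) = \<phi> n" for n by simp
  have a: "a x t = rat_decode (the (\<phi> (prod_encode (x, t))))" for x t
    using \<phi>(2)[of x t] g[of "prod_encode (x, t)"] by (metis option.inject option.simps(9))
  show ?thesis
  proof
    show "recf (\<lambda>n. the (\<phi> n))" using \<phi>(1) by (simp add: recf_def g)
  qed (use \<phi>(3,4) in \<open>simp_all add: a[abs_def]\<close>)
qed

text \<open>The search for a program runs over list codes; requiring entries below 2 singles out the
  codes of bit strings.\<close>

lemma re_K_le:
  assumes "prefix_machine U"
  shows "re (\<lambda>z. K U (pfst z) \<le> enat (psnd z))"
proof -
  obtain \<phi> where \<phi>: "partrec \<phi>" "\<And>p y. U p y = \<phi> (prod_encode (string_enc p, y))"
    using assms unfolding prefix_machine_def by blast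
  have "K U i \<le> enat k \<longleftrightarrow> (\<exists>c. llen c \<le> k \<and> (\<forall>j<llen c. lnth c j < 2) \<and>
      \<phi> (prod_encode (c, 0)) = Some i)" for i k
    unfolding K_def shortest_le_iff
  proof
    assume "\<exists>p. U p 0 = Some i \<and> length p \<le> k"
    then obtain p where "U p 0 = Some i" "length p \<le> k" by blast
    then show "\<exists>c. llen c \<le> k \<and> (\<forall>j<llen c. lnth c j < 2) \<and> \<phi> (prod_encode (c, 0)) = Some i"
      by (intro exI[of _ "string_enc p"]) (auto simp: \<phi>(2) lnth_list_encode)
  next
    assume "\<exists>c. llen c \<le> k \<and> (\<forall>j<llen c. lnth c j < 2) \<and> \<phi> (prod_encode (c, 0)) = Some i"
    then obtain c where c: "llen c \<le> k" "\<And>j. j < llen c \<Longrightarrow> lnth c j < 2"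
      "\<phi> (prod_encode (c, 0)) = Some i" by blast
    define xs where "xs = list_decode c"
    have xs: "c = list_encode xs" by (simp add: xs_def)
    have "map of_bool (map (\<lambda>x. x = 1) xs) = xs"
    proof (rule nth_equalityI)
      show "map of_bool (map (\<lambda>x. x = 1) xs) ! j = xs ! j"
        if "j < length (map of_bool (map (\<lambda>x. x = 1) xs) :: nat list)" for j
        using that c(2)[of j] by (auto simp: xs lnth_list_encode less_2_cases_iff)
    qed simp
    then show "\<exists>p. U p 0 = Some i \<and> length p \<le> k"
      using c(1,3) by (intro exI[of _ "map (\<lambda>x. x = 1) xs"]) (simp add: \<phi>(2) xs del: map_map)
  qed
  then show ?thesis
    by (simp only:) (intro re_ex re_conj re_recp[OF recp_le] re_recp[OF recp_less]
        re_recp[OF recp_all_less] re_graph_comp[OF re_graph_of_partrec[OF \<phi>(1)]] rec_intros)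
qed

text \<open>\<open>2\<close> is the code of the integer 1, and denominators are stored reduced by
  one.\<close>

lemma rat_decode_power_half: "rat_decode (prod_encode (2, 2 ^ m - 1)) = (1 / 2) ^ m"
proof -
  have "int_decode 2 = 1" by (simp add: int_decode_def sum_decode_def)
  moreover have "of_nat (Suc (2 ^ m - 1)) = (2 ^ m :: rat)" by simp
  ultimately show ?thesis
    unfolding rat_decode_def prod_encode_inverse by (simp add: power_one_over del: of_nat_Suc)
qed

lemma rat_decode_0: "rat_decode (prod_encode (0, b)) = 0"
  by (simp add: rat_decode_def int_decode_def sum_decode_def)

text \<open>\<open>K U i\<close> is approximated from above: longer searches certify smaller bounds,
  so the weight of the best bound found so far increases to the true weight.\<close>

lemma enumerable_universal_weight:
  assumes U: "universal_prefix_machine U"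
  shows "enumerable id (universal_weight U)"
proof -
  have "re (\<lambda>z. K U (pfst z) \<le> enat (psnd z))"
    using U unfolding universal_prefix_machine_def by (intro re_K_le) simp
  then obtain D where D: "recp (\<lambda>z. D (pfst z) (psnd z))"
    "\<And>z. K U (pfst z) \<le> enat (psnd z) \<longleftrightarrow> (\<exists>s. D z s)"
    by (rule reE) blast
  have K: "K U i \<le> enat k \<longleftrightarrow> (\<exists>s. D (prod_encode (i, k)) s)" for i k
    using D(2)[of "prod_encode (i, k)"] by simp
  \<comment> \<open>The alternative \<open>k = t\<close> guarantees a minimum;
    \<open>m i t = t\<close> is treated as no bound found and gives the value 0.\<close>
  define m where "m i t = (LEAST k. k = t \<or> (\<exists>s<t. D (prod_encode (i, k)) s))" for i t
  have m_le: "m i t \<le> t" for i t unfolding m_def by (rule Least_le) simp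
  have m_less: "\<exists>s<t. D (prod_encode (i, m i t)) s" if "m i t < t" for i t
    using LeastI[of "\<lambda>k. k = t \<or> (\<exists>s<t. D (prod_encode (i, k)) s)" t] that
    unfolding m_def by auto
  have m_min: "m i t \<le> k" if "D (prod_encode (i, k)) s" "s < t" for i t k s
    unfolding m_def by (rule Least_le) (use that in blast)
  have m_mono: "m i t' \<le> m i t" if "m i t < t" "t \<le> t'" for i t t'
    using m_less[OF that(1)] that(2) by (meson less_le_trans m_min)
  define g where "g z = prod_encode (if m (pfst z) (psnd z) < psnd z then 2 else 0,
    2 ^ m (pfst z) (psnd z) - 1)" for z
  define a where "a i t = (if m i t < t then (1 / 2) ^ m i t else (0 :: rat))" for i t
  have g: "rat_decode (g (prod_encode (i, t))) = a i t" for i t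
    by (simp only: g_def a_def prod_encode_inverse fst_conv snd_conv rat_decode_power_half
        rat_decode_0 if_True if_False split: if_split) simp
  show ?thesis
  proof (rule enumerable_idI[of g], unfold g)
    have "recf (\<lambda>z. m (pfst z) (psnd z))"
      unfolding m_def
      by (intro recf_Least recp_disj recp_ex_less recp_comp2[OF D(1)] rec_intros) blast
    then show "recf g"
      unfolding g_def by (intro recf_comp[OF \<open>recf (\<lambda>z. m (pfst z) (psnd z))\<close>] rec_intros)
  next
    fix i
    show "incseq (a i)"
    proof (rule monoI)
      fix t t' :: nat assume "t \<le> t'"
      show "a i t \<le> a i t'"
      proof (cases "m i t < t")
        case True
        then have "m i t' \<le> m i t" using m_mono \<open>t \<le> t'\<close> by blast
        with True \<open>t \<le> t'\<close> show ?thesis by (simp add: a_def power_decreasing)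
      qed (simp add: a_def)
    qed
    obtain k where k: "K U i = enat k" using K_finite[OF U] .
    then obtain s where s: "D (prod_encode (i, k)) s" using K[of i k] by auto
    \<comment> \<open>By then the witness \<open>s\<close> for the true complexity has been seen,
      and no smaller bound can ever be certified.\<close>
    have "a i t = (1 / 2) ^ k" if "t > max k s" for t
    proof -
      have "m i t \<le> k" using m_min[OF s] that by simp
      moreover from this have "m i t < t" using that by simp
      moreover from this have "K U i \<le> enat (m i t)" using m_less K by blast
      ultimately show ?thesis using k by (simp add: a_def)
    qed
    then have "eventually (\<lambda>t. real_of_rat (a i t) = universal_weight U i) sequentially"
      unfolding eventually_sequentially universal_weight_eq[OF k]
      by (intro exI[of _ "Suc (max k s)"]) (simp add: of_rat_power of_rat_divide Suc_le_eq)
    then show "(\<lambda>t. real_of_rat (a i t)) \<longlonglongrightarrow> universal_weight U i"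
      by (rule tendsto_eventually)
  qed
qed

lemma universal_weight_in_weight_functions:
  assumes U: "universal_prefix_machine U"
  obtains c where "universal_weight U \<in> weight_functions U c"
proof -
  obtain c where c: "K_fun U (universal_weight U) \<le> enat c"
    using K_fun_finite[OF U enumerable_universal_weight[OF U]] .
  have le: "sum (universal_weight U) {..<n} \<le> 1" for n
    by (rule sum_universal_weight_le_1[OF U]) simp
  have "summable (universal_weight U)"
    by (rule summableI_nonneg_bounded[OF _ le]) (simp add: universal_weight_pos[OF U] less_imp_le)
  with le c show ?thesis
    by (intro that[of c])
      (simp add: weight_functions_def universal_weight_pos[OF U] enumerable_universal_weight[OF U]
        suminf_le_const)
qed

section \<open>The Kraft-Chaitin theorem\<close>

text \<open>The binary value of a coded bit string, most significant bit first, computed on the code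
  so that it is recursive.\<close>

definition code_val :: "nat \<Rightarrow> nat" where
  "code_val c = (\<Sum>n<llen c. lnth c (llen c - Suc n) * 2 ^ n)"

lemma recf_code_val [rec_intros]:
  assumes "recf f" shows "recf (\<lambda>x. code_val (f x))"
proof -
  have "recf code_val" unfolding code_val_def by (intro rec_intros)
  then show ?thesis using assms by (rule recf_comp)
qed

abbreviation bin_val :: "bool list \<Rightarrow> nat" where
  "bin_val p \<equiv> horner_sum of_bool 2 (rev p)"

lemma code_val_string_enc: "code_val (string_enc p) = bin_val p"
  unfolding code_val_def horner_sum_eq_sum
  by (simp add: rev_nth lnth_list_encode atLeast0LessThan)

text \<open>Left end of the dyadic interval of length \<open>(1 / 2) ^ length p\<close> belonging to
  \<open>p\<close>.\<close>

definition bin_frac :: "bool list \<Rightarrow> real" where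
  "bin_frac p = bin_val p / 2 ^ length p"

text \<open>The interval of an extension lies inside that of the word, which turns the prefix
  relation into inclusion of intervals.\<close>

lemma bin_frac_append:
  "bin_frac p \<le> bin_frac (p @ r)"
  "bin_frac (p @ r) + (1 / 2) ^ length (p @ r) \<le> bin_frac p + (1 / 2) ^ length p"
proof -
  have r: "real (bin_val r) + 1 \<le> 2 ^ length r"
  proof -
    have "bin_val r < 2 ^ length r" using horner_sum_of_bool_2_less[of "rev r"] by simp
    then have "bin_val r + 1 \<le> 2 ^ length r" by simp
    then have "real (bin_val r + 1) \<le> real (2 ^ length r)" by (rule of_nat_mono)
    then show ?thesis by simp
  qed
  have eq: "bin_frac (p @ r) = bin_frac p + bin_val r / 2 ^ length (p @ r)"
    by (simp add: bin_frac_def horner_sum_append power_add field_simps)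
  show "bin_frac p \<le> bin_frac (p @ r)" by (simp add: eq)
  have "bin_val r / 2 ^ length (p @ r) + (1 / 2) ^ length (p @ r)
      = (real (bin_val r) + 1) / 2 ^ length (p @ r)"
    by (simp add: power_one_over add_divide_distrib)
  also have "\<dots> \<le> 2 ^ length r / 2 ^ length (p @ r)"
    using r by (intro divide_right_mono) simp_all
  also have "\<dots> = (1 / 2) ^ length p" by (simp add: power_add power_one_over)
  finally show "bin_frac (p @ r) + (1 / 2) ^ length (p @ r) \<le> bin_frac p + (1 / 2) ^ length p"
    by (simp add: eq)
qed

lemma ex_bin_val:
  assumes "m < 2 ^ n" obtains p where "length p = n" "bin_val p = m"
  using assms that[of "rev (map (bit m) [0..<n])"]
  by (simp add: horner_sum_bit_eq_take_bit take_bit_nat_eq_self)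

text \<open>The \<open>t\<close>-th request owns the interval between the partial sums \<open>S t\<close> and \<open>S (Suc t)\<close>, and any
  dyadic interval of half its length inside it serves as codeword. As codewords of different
  requests are disjoint intervals, no bookkeeping of free codewords is needed. \<open>N t\<close> is \<open>S t\<close>
  scaled to a natural number.\<close>

lemma Kraft_Chaitin:
  assumes U: "universal_prefix_machine U"
    and "recp A" "recf len" "recf out"
    and bound: "\<And>T. (\<Sum>t<T. if A t then (1 / 2) ^ len t else 0 :: real) \<le> 1"
  obtains d where "\<And>t. A t \<Longrightarrow> K U (out t) \<le> enat (d + len t)"
proof -
  define S :: "nat \<Rightarrow> real" where "S T = (\<Sum>t<T. if A t then (1 / 2) ^ len t else 0)" for T
  \<comment> \<open>\<open>2 ^ E T\<close> is a common denominator of the first \<open>T\<close>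
    requested masses.\<close>
  define E where "E T = (\<Sum>t<T. len t)" for T
  define N :: "nat \<Rightarrow> nat" where "N T = (\<Sum>t<T. if A t then 2 ^ (E T - len t) else 0)" for T
  have N: "real (N T) = S T * 2 ^ E T" for T
  proof -
    have "len t \<le> E T" if "t < T" for t
      unfolding E_def using that by (intro member_le_sum) auto
    then have "(2 :: real) ^ (E T - len t) = (1 / 2) ^ len t * 2 ^ E T" if "t < T" for t
      using that by (simp add: power_diff power_one_over)
    then show ?thesis unfolding N_def S_def of_nat_sum sum_distrib_right
      by (intro sum.cong refl) simp
  qed
  have S_mono: "S T \<le> S T'" if "T \<le> T'" for T T'
    unfolding S_def using that by (intro sum_mono2) auto
  define codeword where "codeword p t \<longleftrightarrow> A t \<and> length p = Suc (len t) \<and>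
    S t \<le> bin_frac p \<and> bin_frac p + (1 / 2) ^ length p \<le> S (Suc t)" for p t
  \<comment> \<open>The condition \<open>codeword\<close> with denominators cleared: an inequality
    between natural numbers, hence decidable.\<close>
  define R where "R c t \<longleftrightarrow> A t \<and> llen c = Suc (len t) \<and>
    N t * 2 ^ Suc (len t) \<le> code_val c * 2 ^ E t \<and>
    (code_val c + 1) * 2 ^ E (Suc t) \<le> N (Suc t) * 2 ^ Suc (len t)" for c t
  have R: "R (string_enc p) t \<longleftrightarrow> codeword p t" for p t
  proof (cases "length p = Suc (len t)")
    case True
    have "N t * 2 ^ length p \<le> bin_val p * 2 ^ E t \<longleftrightarrow>
        real (N t) * 2 ^ length p \<le> real (bin_val p) * 2 ^ E t"
      by (metis (mono_tags, lifting) of_nat_le_iff of_nat_mult of_nat_numeral of_nat_power)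
    also have "\<dots> \<longleftrightarrow> S t \<le> bin_frac p"
      by (simp add: N bin_frac_def field_simps)
    finally have 1: "N t * 2 ^ length p \<le> bin_val p * 2 ^ E t \<longleftrightarrow> S t \<le> bin_frac p" .
    have "(bin_val p + 1) * 2 ^ E (Suc t) \<le> N (Suc t) * 2 ^ length p \<longleftrightarrow>
        (real (bin_val p) + 1) * 2 ^ E (Suc t) \<le> real (N (Suc t)) * 2 ^ length p"
      by (metis (mono_tags, lifting) of_nat_le_iff of_nat_mult of_nat_numeral of_nat_power
          of_nat_add of_nat_1)
    also have "\<dots> \<longleftrightarrow> (real (bin_val p) + 1) * 2 ^ E (Suc t) \<le> S (Suc t) * 2 ^ length p * 2 ^ E (Suc t)"
      by (simp only: N mult_ac)
    also have "\<dots> \<longleftrightarrow> real (bin_val p) + 1 \<le> S (Suc t) * 2 ^ length p"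
      by (rule mult_le_cancel_right_pos) simp
    also have "\<dots> \<longleftrightarrow> bin_frac p + (1 / 2) ^ length p \<le> S (Suc t)"
      by (simp add: bin_frac_def power_one_over pos_divide_le_eq flip: add_divide_distrib)
    finally show ?thesis using 1 True by (simp add: R_def codeword_def code_val_string_enc)
  qed (simp add: R_def codeword_def)
  have codeword_prefix: "t = t' \<and> p = q" if "codeword p t" "codeword q t'" "prefix p q" for p q t t'
  proof -
    from that(3) obtain r where q: "q = p @ r" by (auto simp: prefix_def)
    \<comment> \<open>The nonempty interval of \<open>q\<close> lies in both request intervals, so
      these overlap and the requests coincide; equal lengths then give \<open>p = q\<close>.\<close>
    have "bin_frac q < bin_frac q + (1 / 2) ^ length q" by simp
    with that(1,2) bin_frac_append[of p r] have "S t < S (Suc t')" "S t' < S (Suc t)"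
      unfolding codeword_def q by linarith+
    with S_mono[of "Suc t'" t] S_mono[of "Suc t" t'] have "t = t'" by linarith
    with that show ?thesis by (auto simp: codeword_def q)
  qed
  have ex_codeword: "\<exists>p. codeword p t" if "A t" for t
  proof -
    define n where "n = Suc (len t)"
    \<comment> \<open>Round the left end up to the grid of mesh \<open>(1 / 2) ^ n\<close>. The
      request interval spans two cells, so after a loss of less than one cell a full cell still
      fits.\<close>
    define m where "m = nat \<lceil>S t * 2 ^ n\<rceil>"
    have S_nonneg: "0 \<le> S t" unfolding S_def by (intro sum_nonneg) auto
    then have m: "S t * 2 ^ n \<le> real m" "real m < S t * 2 ^ n + 1"
      unfolding m_def by (auto simp: ceiling_less_iff) linarith+
    have S_Suc: "S (Suc t) * 2 ^ n = S t * 2 ^ n + 2"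
      using that by (simp add: S_def n_def power_one_over field_simps)
    have "S (Suc t) * 2 ^ n \<le> 2 ^ n" using bound[of "Suc t"] by (simp add: S_def)
    with m(2) S_Suc have "real m < 2 ^ n" by linarith
    then have "m < 2 ^ n" by (metis of_nat_less_iff of_nat_numeral of_nat_power)
    then obtain p where p: "length p = n" "bin_val p = m" by (rule ex_bin_val)
    have "(real m + 1) / 2 ^ n \<le> S (Suc t)"
      using m(2) S_Suc by (simp add: pos_divide_le_eq)
    moreover have "S t \<le> real m / 2 ^ n" using m(1) by (simp add: pos_le_divide_eq)
    ultimately have "codeword p t"
      using that p by (simp add: codeword_def bin_frac_def n_def power_one_over add_divide_distrib)
    then show ?thesis by blast
  qed
  have rec_E: "recf E" unfolding E_def by (intro recf_comp[OF assms(3)] rec_intros)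
  have rec_N: "recf N" unfolding N_def
    by (intro recf_comp[OF assms(3)] recp_comp[OF assms(2)] recf_comp[OF rec_E] rec_intros)
  \<comment> \<open>\<open>pfst (pfst z)\<close> is the code of the program; the input of the
    machine is ignored.\<close>
  have "re (\<lambda>z. \<exists>t. R (pfst (pfst z)) t \<and> out t = psnd z)"
    unfolding R_def
    by (intro re_ex re_recp recf_comp[OF assms(3)] recp_comp[OF assms(2)] recf_comp[OF assms(4)]
        recf_comp[OF rec_E] recf_comp[OF rec_N] rec_intros)
  then obtain V where V: "prefix_machine V"
    "\<And>p y m. V p y = Some m \<Longrightarrow> \<exists>t. codeword p t \<and> out t = m"
    "\<And>p y m. \<exists>t. codeword p t \<and> out t = m \<Longrightarrow> V p y \<noteq> None"
    by (rule prefix_machine_uniformize) (auto simp: R dest: codeword_prefix)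
  obtain s where s: "\<And>p y. U (s @ p) y = V p y"
    using U V(1) unfolding universal_prefix_machine_def by blast
  show ?thesis
  \<comment> \<open>\<open>s\<close> pays for the simulation, the extra bit for halving the request
    interval.\<close>
  proof (rule that[of "length s + 1"])
    fix t assume "A t"
    then obtain p where p: "codeword p t" using ex_codeword by blast
    then obtain m where m: "V p 0 = Some m" using V(3)[of p "out t" 0] by auto
    then obtain t' where "codeword p t'" "out t' = m" using V(2) by blast
    with p m have "V p 0 = Some (out t)" using codeword_prefix[of p t p t'] by simp
    with p show "K U (out t) \<le> enat (length s + 1 + len t)"
      unfolding K_def shortest_le_iff by (intro exI[of _ "s @ p"]) (simp add: s codeword_def)
  qed
qed

section \<open>Dominance of the universal weights\<close>

text \<open>Bounds the quantifier so that the closure rules apply to evenness.\<close>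

lemma even_iff_ex: "even n \<longleftrightarrow> (\<exists>q<Suc n. n = 2 * q)" for n :: nat
  by (auto elim!: evenE)

text \<open>Even codes \<open>2 * q\<close> stand for the integer \<open>q\<close> and odd ones for
  negative integers, so the comparison of rationals becomes decidable arithmetic on codes.\<close>

lemma power_half_less_rat_decode_iff:
  "(1 / 2) ^ k < rat_decode n \<longleftrightarrow>
    even (pfst n) \<and> 2 * Suc (psnd n) < 2 ^ k * pfst n"
proof -
  obtain x y where n: "prod_decode n = (x, y)" by fastforce
  have *: "(1 / 2) ^ k < (of_int z / of_nat (Suc y) :: rat) \<longleftrightarrow> int (Suc y) < 2 ^ k * z" for z
  proof -
    have "(1 / 2) ^ k < (of_int z / of_nat (Suc y) :: rat) \<longleftrightarrow>
        (of_int (int (Suc y)) :: rat) < of_int (2 ^ k * z)"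
      by (simp add: power_one_over divide_simps mult_ac del: of_nat_Suc)
    then show ?thesis by (simp only: of_int_less_iff)
  qed
  have iff: "(1 / 2) ^ k < rat_decode n \<longleftrightarrow> int (Suc y) < 2 ^ k * int_decode x"
    unfolding rat_decode_def n by (simp only: prod.case *)
  show ?thesis
  proof (cases "even x")
    case True
    then obtain q where q: "x = 2 * q" by (auto elim: evenE)
    then have "int_decode x = int q" by (simp add: int_decode_def sum_decode_def)
    moreover have "int (Suc y) < 2 ^ k * int q \<longleftrightarrow> Suc y < 2 ^ k * q"
      by (metis of_nat_less_iff of_nat_mult of_nat_numeral of_nat_power)
    moreover have "Suc y < 2 ^ k * q \<longleftrightarrow> 2 * Suc y < 2 ^ k * x"
    proof -
      have "a < b \<longleftrightarrow> 2 * a < 2 * b" for a b :: nat by simp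
      then show ?thesis unfolding q mult.left_commute[of "2 ^ k" 2 q] by blast
    qed
    ultimately show ?thesis using True by (simp only: iff n fst_conv snd_conv simp_thms)
  next
    case False
    then have "int_decode x < 0" by (simp add: int_decode_def sum_decode_def)
    then have "\<not> int (Suc y) < 2 ^ k * int_decode x"
      by (smt (verit) mult_pos_neg of_nat_0_le_iff zero_less_power)
    with False show ?thesis by (simp only: iff n fst_conv snd_conv simp_thms)
  qed
qed

text \<open>A geometric series starting at the least admissible exponent \<open>k0\<close> stays
  below \<open>(1 / 2) ^ k0 < x\<close>. This bounds the mass requested for one index.\<close>

lemma sum_power_half_less:
  fixes x :: real
  assumes "0 \<le> x" shows "(\<Sum>k | k < T \<and> (1 / 2) ^ k < x. (1 / 2) ^ Suc k) \<le> x"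
proof (cases "\<exists>k. k < T \<and> (1 / 2) ^ k < x")
  case True
  define k0 where "k0 = (LEAST k. k < T \<and> (1 / 2) ^ k < x)"
  from LeastI_ex[OF True] have k0: "k0 < T" "(1 / 2) ^ k0 < x" by (simp_all only: k0_def)
  have k0_le: "k0 \<le> k" if "k < T \<and> (1 / 2) ^ k < x" for k
    unfolding k0_def using that by (rule Least_le)
  have "(\<Sum>k | k < T \<and> (1 / 2) ^ k < x. (1 / 2) ^ Suc k) \<le> (\<Sum>k\<in>{k0..<T}. (1 / 2) ^ Suc k :: real)"
    using k0_le by (intro sum_mono2) auto
  also have "\<dots> = (1 / 2) ^ k0 - (1 / 2) ^ T"
    using less_imp_le[OF k0(1)] by (induction T rule: dec_induct) auto
  also have "\<dots> \<le> x"
  proof -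
    have "0 \<le> (1 / 2 :: real) ^ T" by simp
    with k0(2) show ?thesis by linarith
  qed
  finally show ?thesis .
next
  case False
  then have empty: "{k. k < T \<and> (1 / 2) ^ k < x} = {}" by blast
  show ?thesis unfolding empty using assms by simp
qed

lemma universal_weight_dominates:
  assumes U: "universal_prefix_machine U"
    and v: "enumerable id v" "\<And>i. 0 < v i" "summable v" "suminf v \<le> 1"
  obtains C where "C > 0" "\<And>i. v i \<le> C * universal_weight U i"
proof -
  obtain g where g: "recf g" "\<And>x. incseq (\<lambda>t. rat_decode (g (prod_encode (x, t))))"
    "\<And>x. (\<lambda>t. real_of_rat (rat_decode (g (prod_encode (x, t))))) \<longlonglongrightarrow> v x"
    by (rule enumerable_idE[OF v(1)]) blast
  define a where "a i s = rat_decode (g (prod_encode (i, s)))" for i s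
  have a_le: "real_of_rat (a i s) \<le> v i" for i s
    by (rule incseq_le[OF _ g(3)[of i], of s, folded a_def])
      (use g(2)[of i] in \<open>auto simp: incseq_def of_rat_less_eq a_def\<close>)
  define big where "big i k s \<longleftrightarrow> (1 / 2) ^ k < a i s" for i k s
  have big_iff: "(\<exists>s. big i k s) \<longleftrightarrow> (1 / 2) ^ k < v i" for i k
  proof
    assume "\<exists>s. big i k s"
    then obtain s where "(1 / 2) ^ k < a i s" by (auto simp: big_def)
    then have "real_of_rat ((1 / 2) ^ k) < real_of_rat (a i s)" by (simp only: of_rat_less)
    with a_le[of i s] show "(1 / 2) ^ k < v i" by (simp add: of_rat_power of_rat_divide)
  next
    assume "(1 / 2) ^ k < v i"
    then have "eventually (\<lambda>s. (1 / 2) ^ k < real_of_rat (a i s)) sequentially"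
      using order_tendstoD(1)[OF g(3)[of i]] by (simp add: a_def)
    then obtain s where "(1 / 2) ^ k < real_of_rat (a i s)"
      by (auto simp: eventually_sequentially)
    then have "real_of_rat ((1 / 2) ^ k) < real_of_rat (a i s)"
      by (simp add: of_rat_power of_rat_divide)
    then show "\<exists>s. big i k s" unfolding big_def of_rat_less by blast
  qed
  have rec_big: "recp (\<lambda>x. big (f1 x) (f2 x) (f3 x))" if "recf f1" "recf f2" "recf f3" for f1 f2 f3
    unfolding big_def a_def power_half_less_rat_decode_iff even_iff_ex
    by (intro recp_conj recp_ex_less recf_comp[OF g(1)] recf_comp[OF that(1)] recf_comp[OF that(2)]
        recf_comp[OF that(3)] rec_intros)
  \<comment> \<open>Each number is read as a triple of index, level and stage; \<open>A\<close>
    selects those that are requests.\<close>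
  define out where "out t = pfst t" for t
  define lev where "lev t = pfst (psnd t)" for t
  define stg where "stg t = psnd (psnd t)" for t
  \<comment> \<open>Only the first stage that passes the level counts, so each pair of index and
    level is requested at most once.\<close>
  define A where "A t \<longleftrightarrow> big (out t) (lev t) (stg t) \<and>
    (\<forall>s<stg t. \<not> big (out t) (lev t) s)" for t
  have eqI: "t = t'" if "out t = out t'" "lev t = lev t'" "stg t = stg t'" for t t'
  proof -
    have "t = prod_encode (out t, prod_encode (lev t, stg t))" for t
      by (simp add: out_def lev_def stg_def)
    with that show ?thesis by metis
  qed
  \<comment> \<open>Pairing dominates its components, which confines the requests below
    \<open>T\<close> to indices and levels below \<open>T\<close>.\<close>
  have pfst_le: "pfst t \<le> t" and psnd_le: "psnd t \<le> t" for t
    using le_prod_encode_1[of "pfst t" "psnd t"] le_prod_encode_2[of "psnd t" "pfst t"] by simp_all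
  then have le: "out t \<le> t" "lev t \<le> t" for t
    unfolding out_def lev_def by (blast intro: order_trans)+
  have bound: "(\<Sum>t<T. if A t then (1 / 2) ^ Suc (lev t) else 0 :: real) \<le> 1" for T
  proof -
    let ?B = "{t. t < T \<and> A t}"
    have "inj_on (\<lambda>t. (out t, lev t)) ?B"
    proof (rule inj_onI)
      fix t t' assume "t \<in> ?B" "t' \<in> ?B" "(out t, lev t) = (out t', lev t')"
      then have A: "A t" "A t'" and eq: "out t = out t'" "lev t = lev t'" by simp_all
      have "stg t = stg t'"
        using A linorder_less_linear[of "stg t" "stg t'"] unfolding A_def eq by auto
      with eq show "t = t'" by (rule eqI)
    qed
    then have "(\<Sum>t\<in>?B. (1 / 2) ^ Suc (lev t) :: real)
        = (\<Sum>(i, k)\<in>(\<lambda>t. (out t, lev t)) ` ?B. (1 / 2) ^ Suc k)"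
      by (simp add: sum.reindex)
    also have "\<dots> \<le> (\<Sum>(i, k)\<in>(SIGMA i:{..<T}. {k. k < T \<and> (1 / 2) ^ k < v i}). (1 / 2) ^ Suc k)"
    proof (rule sum_mono2)
      have "out t < T \<and> lev t < T \<and> (1 / 2) ^ lev t < v (out t)" if "t < T" "A t" for t
        using le[of t] that big_iff[of "out t" "lev t"] unfolding A_def by auto
      then show "(\<lambda>t. (out t, lev t)) ` ?B \<subseteq> (SIGMA i:{..<T}. {k. k < T \<and> (1 / 2) ^ k < v i})"
        by blast
    qed auto
    also have "\<dots> = (\<Sum>i<T. \<Sum>k | k < T \<and> (1 / 2) ^ k < v i. (1 / 2) ^ Suc k)"
      by (rule sum.Sigma[symmetric]) auto
    also have "\<dots> \<le> (\<Sum>i<T. v i)"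
      using v(2) by (intro sum_mono sum_power_half_less) (simp add: less_imp_le)
    also have "\<dots> \<le> suminf v"
      using v(2,3) by (intro sum_le_suminf) (auto intro: less_imp_le)
    finally have "(\<Sum>t\<in>?B. (1 / 2) ^ Suc (lev t) :: real) \<le> 1" using v(4) by simp
    moreover have "(\<Sum>t<T. if A t then (1 / 2) ^ Suc (lev t) else 0 :: real)
        = (\<Sum>t\<in>?B. (1 / 2) ^ Suc (lev t))"
      by (rule sum.mono_neutral_cong_right) auto
    ultimately show ?thesis by simp
  qed
  have rec: "recf out" "recf lev" "recf stg"
    unfolding out_def lev_def stg_def by (intro rec_intros)+
  have rec_A: "recp A" unfolding A_def
    by (intro recp_conj recp_all_less recp_not rec_big recf_comp[OF rec(1)] recf_comp[OF rec(2)]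
      recf_comp[OF rec(3)] rec_intros)
  obtain d where d: "\<And>t. A t \<Longrightarrow> K U (out t) \<le> enat (d + Suc (lev t))"
    using Kraft_Chaitin[OF U rec_A recf_Suc[OF rec(2)] rec(1) bound] by blast
  show ?thesis
  \<comment> \<open>Besides \<open>d\<close>, one factor 2 comes from \<open>Suc (lev t)\<close> and
    one from rounding \<open>v i\<close> down to a power of 2.\<close>
  proof (rule that[of "2 ^ (d + 2)"])
    fix i
    obtain k where k: "(1 / 2) ^ k < v i" "\<And>j. j < k \<Longrightarrow> \<not> (1 / 2) ^ j < v i"
      using exists_least_iff[of "\<lambda>k. (1 / 2) ^ k < v i"] real_arch_pow_inv[of "v i" "1 / 2"] v(2)[of i]
      by auto
    \<comment> \<open>Excludes \<open>k = 0\<close>, so that there is a preceding level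
      \<open>j\<close>, which \<open>v i\<close> does not exceed.\<close>
    have "v i \<le> 1"
      using sum_le_suminf[OF v(3), of "{i}"] v(2,4) by (simp add: less_imp_le)
    with k have "k \<noteq> 0" by (intro notI) simp
    then obtain j where j: "k = Suc j" by (cases k) auto
    with k(2)[of j] have vi: "v i \<le> (1 / 2) ^ j" by simp
    obtain s where s: "big i k s" "\<And>s'. s' < s \<Longrightarrow> \<not> big i k s'"
      using k(1) exists_least_iff[of "big i k"] by (auto simp: big_iff[symmetric])
    define t where "t = prod_encode (i, prod_encode (k, s))"
    have t: "out t = i" "lev t = k" "stg t = s"
      by (simp_all add: t_def out_def lev_def stg_def)
    with s have "A t" by (simp add: A_def)
    from universal_weight_ge[OF U d[OF this]]
    have "(1 / 2) ^ (d + Suc k) \<le> universal_weight U i" by (simp add: t)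
    then have "2 ^ (d + 2) * (1 / 2) ^ (d + Suc k) \<le> 2 ^ (d + 2) * universal_weight U i"
      by (intro mult_left_mono) simp_all
    moreover have "2 ^ (d + 2) * (1 / 2) ^ (d + Suc k) = ((1 / 2) ^ j :: real)"
      by (simp add: j power_add power_one_over)
    ultimately show "v i \<le> 2 ^ (d + 2) * universal_weight U i" using vi by linarith
  qed simp
qed

section \<open>One constant for all weight functions of bounded complexity\<close>

lemma approximates_below_unique:
  assumes "approximates_below code \<phi> v" "approximates_below code \<phi> v'" shows "v = v'"
proof -
  from assms obtain a a' where
    a: "\<And>x t. map_option rat_decode (\<phi> (prod_encode (code x, t))) = Some (a x t)"
      "\<And>x. (\<lambda>t. real_of_rat (a x t)) \<longlonglongrightarrow> v x" and
    a': "\<And>x t. map_option rat_decode (\<phi> (prod_encode (code x, t))) = Some (a' x t)"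
      "\<And>x. (\<lambda>t. real_of_rat (a' x t)) \<longlonglongrightarrow> v' x"
    unfolding approximates_below_def by blast
  have "a = a'" by (intro ext) (metis a(1) a'(1) option.inject)
  with a(2) a'(2) show ?thesis by (intro ext) (metis LIMSEQ_unique)
qed

lemma finite_weight_functions: "finite (weight_functions U c)"
proof (rule finite_subset)
  \<comment> \<open>The value of \<open>THE\<close> is arbitrary on programs enumerating nothing,
    but an inclusion suffices for finiteness.\<close>
  let ?F = "\<lambda>p. THE v. approximates_below id (U p) v"
  show "weight_functions U c \<subseteq> ?F ` {p. length p \<le> c}"
  proof
    fix v assume "v \<in> weight_functions U c"
    then obtain p where p: "approximates_below id (U p) v" "length p \<le> c"
      unfolding weight_functions_def K_fun_def shortest_le_iff by blast
    then have "v = ?F p" by (intro the_equality[symmetric]) (auto intro: approximates_below_unique)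
    with p(2) show "v \<in> ?F ` {p. length p \<le> c}" by blast
  qed
  show "finite (?F ` {p. length p \<le> c})" by (intro finite_imageI finite_bool_lists)
qed

text \<open>Dominance gives a constant for each \<open>v\<close>; the sum of their absolute values
  over the finite class serves all \<open>v\<close> at once.\<close>

lemma ln_inverse_universal_weight_le:
  assumes U: "universal_prefix_machine U"
  obtains C where "\<And>v i. v \<in> weight_functions U c \<Longrightarrow>
    ln (inverse (universal_weight U i)) \<le> ln (inverse (v i)) + C"
proof -
  have "\<exists>C. \<forall>i. ln (inverse (universal_weight U i)) \<le> ln (inverse (v i)) + C"
    if "v \<in> weight_functions U c" for v
  proof -
    from that have v: "enumerable id v" "\<And>i. 0 < v i" "summable v" "suminf v \<le> 1"
      by (auto simp: weight_functions_def)
    obtain C where C: "C > 0" "\<And>i. v i \<le> C * universal_weight U i"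
      using universal_weight_dominates[OF U v] by blast
    have "ln (v i) \<le> ln C + ln (universal_weight U i)" for i
      using C v(2)[of i] universal_weight_pos[OF U, of i]
      by (subst ln_mult_pos[symmetric]) (auto simp: ln_le_cancel_iff)
    then show ?thesis
      using v(2) universal_weight_pos[OF U] by (intro exI[of _ "ln C"]) (simp add: ln_inverse algebra_simps)
  qed
  then obtain C where C: "\<And>v i. v \<in> weight_functions U c \<Longrightarrow>
    ln (inverse (universal_weight U i)) \<le> ln (inverse (v i)) + C v" by metis
  have "C v \<le> (\<Sum>v\<in>weight_functions U c. \<bar>C v\<bar>)" if "v \<in> weight_functions U c" for v
    using member_le_sum[OF that, of "\<lambda>v. \<bar>C v\<bar>"] finite_weight_functions[of U c] by auto
  with C show ?thesis
    by (intro that[of "\<Sum>v\<in>weight_functions U c. \<bar>C v\<bar>"]) (smt (verit))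
qed

lemma B_L_mono: "0 \<le> L \<Longrightarrow> b \<le> b' \<Longrightarrow> B_L L b \<le> B_L L b'"
  unfolding B_L_def by (intro add_mono mult_left_mono real_sqrt_le_mono mult_right_mono) auto

lemma total_loss_nonneg:
  assumes "\<And>x. 0 \<le> \<rho> x" "\<And>x y. 0 \<le> l x y" shows "0 \<le> total_loss \<rho> l \<Lambda> n"
  unfolding total_loss_def by (intro sum_nonneg mult_nonneg_nonneg assms)

theorem theorem7:
  fixes U :: machine
    and \<nu> :: "nat \<Rightarrow> 'a::finite list \<Rightarrow> real"
  assumes "universal_prefix_machine U"
    and "enumerates_semimeasures \<nu>"
  shows "(\<exists>c. universal_weight U \<in> weight_functions U c) \<and>
    (\<forall>c. \<exists>C::real. \<forall>v\<in>weight_functions U c. \<forall>i.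
       ln (inverse (universal_weight U i)) \<le> ln (inverse (v i)) + C \<and>
       B_S (ln (inverse (universal_weight U i))) \<le> B_S (ln (inverse (v i)) + C) \<and>
       (\<forall>(l :: 'a \<Rightarrow> 'y \<Rightarrow> real) \<Lambda> n.
          (\<forall>x y. l x y \<in> {0..1}) \<and> optimal_scheme (\<nu> i) l \<Lambda> \<longrightarrow>
          B_L (total_loss (\<nu> i) l \<Lambda> n) (ln (inverse (universal_weight U i)))
            \<le> B_L (total_loss (\<nu> i) l \<Lambda> n) (ln (inverse (v i)) + C)))"
proof (intro conjI allI)
  show "\<exists>c. universal_weight U \<in> weight_functions U c"
    using universal_weight_in_weight_functions[OF assms(1)] by blast
next
  fix c
  obtain C where C: "\<And>v i. v \<in> weight_functions U c \<Longrightarrow>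
    ln (inverse (universal_weight U i)) \<le> ln (inverse (v i)) + C"
    using ln_inverse_universal_weight_le[OF assms(1)] by blast
  \<comment> \<open>Nonnegativity of \<open>\<nu> i\<close> makes the total loss nonnegative, on
    which the monotonicity of \<open>B_L\<close> rests.\<close>
  have "semimeasure (\<nu> i)" for i
    using assms(2) unfolding enumerates_semimeasures_def by blast
  then have "0 \<le> \<nu> i x" for i x by (simp add: semimeasure_def)
  with C show "\<exists>C::real. \<forall>v\<in>weight_functions U c. \<forall>i.
       ln (inverse (universal_weight U i)) \<le> ln (inverse (v i)) + C \<and>
       B_S (ln (inverse (universal_weight U i))) \<le> B_S (ln (inverse (v i)) + C) \<and>
       (\<forall>(l :: 'a \<Rightarrow> 'y \<Rightarrow> real) \<Lambda> n.
          (\<forall>x y. l x y \<in> {0..1}) \<and> optimal_scheme (\<nu> i) l \<Lambda> \<longrightarrow>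
          B_L (total_loss (\<nu> i) l \<Lambda> n) (ln (inverse (universal_weight U i)))
            \<le> B_L (total_loss (\<nu> i) l \<Lambda> n) (ln (inverse (v i)) + C))"
    by (intro exI[of _ C]) (auto simp: B_S_def intro!: B_L_mono total_loss_nonneg)
qed

end
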